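(* Let $F$ be a distribution on $\mathbb R_+=[0,\infty)$ and let $N\ge1$ be an integer. Let $c>0$ and $\Delta=(0,c]$. If $F\in\mathcal A_\Delta$ and $F^{*N}\in\mathcal S_\Delta$, then $F\in\mathcal S_\Delta$. Thus, if $F\in\mathcal A_{loc}$ and $F^{*N}\in\mathcal S_{loc}$, then $F\in\mathcal S_{loc}$.
   Context: For $\Delta=(0,c]$ and a distribution $F$, $F(x+\Delta):=F((x,x+c])$. $F^{*n}$ is the $n$-fold convolution. $\alpha(x)\sim\beta(x)$ means $\alpha(x)/\beta(x)\to1$ as $x\to\infty$. A non-negative measurable function $\alpha$ belongs to $\mathcal L$ if there is $x_0>0$ with $\alpha(x)>0$ for $x\ge x_0$ and, for every fixed $y>0$, $\alpha(x+y)\sim\alpha(x)$. $F\in\mathcal L_\Delta$ if $x\mapsto F(x+\Delta)$ is in $\mathcal L$; $F\in\mathcal S_\Delta$ if $F\in\mathcal L_\Delta$ and $F^{*2}(x+\Delta)\sim 2F(x+\Delta)$. A function $\alpha:\mathbb R\to\mathbb R_+$ is asymptotic to a non-increasing function if for some $x_0>0$ it is locally bounded and positive on $[x_0,\infty)$, and $\sup_{t\ge x}\alpha(t)\sim\alpha(x)$ and $\inf_{x_0\le t\le x}\alpha(t)\sim\alpha(x)$. $F\in\mathcal A_\Delta$ if $x\mapsto F(x+\Delta)$ is asymptotic to a non-increasing function in this sense. $F\in\mathcal S_{loc}$ (resp. $\mathcal A_{loc}$) if $F\in\mathcal S_\Delta$ (resp. $\mathcal A_\Delta$) for all $\Delta=(0,c]$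 with $c>0$. *)

theory Defs
  imports "HOL-Probability.Probability" "HOL-Library.Landau_Symbols"
begin

definition ivl_prob :: "real \<Rightarrow> real measure \<Rightarrow> real \<Rightarrow> real" where
  "ivl_prob c F x = measure F {x<..x + c}"

primrec conv_power :: "real measure \<Rightarrow> nat \<Rightarrow> real measure" where
  "conv_power F 0 = return borel 0"
| "conv_power F (Suc n) = convolution F (conv_power F n)"

lemma conv_power_1:
  assumes "real_distribution F"
  shows "conv_power F 1 = F"
proof -
  interpret real_distribution F by fact
  interpret R: prob_space "return borel (0::real)" by (rule prob_space_return) simp
  have "convolution F (return borel 0) = F"
  proof (rule measure_eqI)
    fix A assume "A \<in> sets (convolution F (return borel 0))"
    then have A: "A \<in> sets borel" by simp
    have meas: "{a. a + x \<in> A} \<in> sets borel" for x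
      using measurable_sets[of "\<lambda>a. a + x" borel borel A] A by (simp add: vimage_def)
    have "emeasure (convolution F (return borel 0)) A =
        (\<integral>\<^sup>+x. emeasure (return borel 0) {a. a + x \<in> A} \<partial>F)"
      using A finite_measure_axioms R.finite_measure_axioms by (intro convolution_emeasure) auto
    also have "\<dots> = (\<integral>\<^sup>+x. indicator A x \<partial>F)"
      using meas by (intro nn_integral_cong) (simp add: indicator_def)
    also have "\<dots> = emeasure F A"
      using A by simp
    finally show "emeasure (convolution F (return borel 0)) A = emeasure F A" .
  qed simp
  then show ?thesis by simp
qed

lemma conv_power_2:
  assumes "real_distribution F"
  shows "conv_power F 2 = convolution F F"
  using conv_power_1[OF assms] by (simp add: numeral_2_eq_2)

text \<open>The library relation \<open>\<sim>[at_top]\<close> counts the quotient \<open>0 / 0\<close> as \<open>1\<close>. This convention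
  has no effect in the classes below: each of them requires the function concerned to be
  positive on a half-line, so that the relation means that the quotient tends to \<open>1\<close>.\<close>

definition class_L :: "(real \<Rightarrow> real) set" where
  "class_L = {\<alpha>. \<alpha> \<in> borel_measurable borel \<and> (\<forall>x. 0 \<le> \<alpha> x) \<and>
     (\<exists>x0>0. \<forall>x\<ge>x0. 0 < \<alpha> x) \<and>
     (\<forall>y>0. (\<lambda>x. \<alpha> (x + y)) \<sim>[at_top] \<alpha>)}"

text \<open>In the type \<^typ>\<open>real\<close> the supremum of an unbounded set is a junk value; the \<open>bdd_above\<close>
  condition says that the suprema are finite for large \<open>x\<close>, which is implicit in their being
  asymptotic to \<open>\<alpha>\<close>.\<close>

definition asymp_nonincreasing :: "(real \<Rightarrow> real) \<Rightarrow> bool" where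
  "asymp_nonincreasing \<alpha> \<longleftrightarrow> (\<forall>x. 0 \<le> \<alpha> x) \<and>
     (\<exists>x0>0. (\<forall>K. compact K \<and> K \<subseteq> {x0..} \<longrightarrow> bounded (\<alpha> ` K)) \<and>
        (\<forall>x\<ge>x0. 0 < \<alpha> x) \<and>
        (\<forall>\<^sub>F x in at_top. bdd_above (\<alpha> ` {x..})) \<and>
        (\<lambda>x. SUP t\<in>{x..}. \<alpha> t) \<sim>[at_top] \<alpha> \<and>
        (\<lambda>x. INF t\<in>{x0..x}. \<alpha> t) \<sim>[at_top] \<alpha>)"

text \<open>The parameter \<open>c\<close> of the following classes stands for \<open>\<Delta> = (0, c]\<close>.\<close>

definition L_Delta :: "real \<Rightarrow> real measure set" where
  "L_Delta c = {F. ivl_prob c F \<in> class_L}"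

definition S_Delta :: "real \<Rightarrow> real measure set" where
  "S_Delta c = {F. F \<in> L_Delta c \<and>
     ivl_prob c (conv_power F 2) \<sim>[at_top] (\<lambda>x. 2 * ivl_prob c F x)}"

definition A_Delta :: "real \<Rightarrow> real measure set" where
  "A_Delta c = {F. asymp_nonincreasing (ivl_prob c F)}"

definition S_loc :: "real measure set" where
  "S_loc = {F. \<forall>c>0. F \<in> S_Delta c}"

definition A_loc :: "real measure set" where
  "A_loc = {F. \<forall>c>0. F \<in> A_Delta c}"

end

theory Submission
  imports Defs
begin

text \<open>Write \<open>f x = F((x, x + c])\<close>, \<open>f\<^sub>n\<close> for the same function of the \<open>n\<close>-th convolution power of \<open>F\<close>,
  \<open>G\<close> for the \<open>N\<close>-th power and \<open>g = f\<^sub>N\<close>. The aim is \<open>g \<sim> N f\<close> and \<open>f\<^sub>2 \<sim> 2 f\<close>: since \<open>g\<close> is long-tailed,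
  the first relation makes \<open>f\<close> long-tailed as well.

  A sum of \<open>n\<close> summands is large in \<open>n\<close> ways through one large summand. As \<open>f\<close> is almost decreasing,
  this gives \<open>f\<^sub>n \<ge> (n - \<epsilon>) f\<close> eventually (\<open>conv_power_ge\<close>). Conversely, the single large summand
  contributes at most \<open>(n + \<epsilon>) f (x - T)\<close> for some shift \<open>T\<close>, and it remains to show that sums with two
  large summands contribute at most \<open>\<epsilon> g x\<close> (\<open>conv_power_le\<close>). The shift then disappears because \<open>g\<close> is
  long-tailed: \<open>g (x + T) \<sim> g x\<close>, which is all that is needed for \<open>n = N\<close>; and once \<open>f\<close> is known to be
  long-tailed, the case \<open>n = 2\<close> follows.

  Two large summands are excluded by local subexponentiality of \<open>G\<close>: in a sum of two independent
  variables distributed as \<open>G\<close>, the event that both are large has probability \<open>o(g x)\<close>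
  (\<open>S_Delta_middle_negligible\<close>). This carries over to any two summands whose interval probabilities are
  dominated by \<open>g\<close> (\<open>middle_negligible_dominated\<close>), and the bound \<open>f\<^sub>n \<le> C g\<close> required for this is a
  consequence of the upper bound for \<open>f\<^sub>n\<close>, so that both are proved in one induction on \<open>n\<close>.

  Because \<open>g (x - y) / g x\<close> is only known to converge for each \<open>y\<close> separately, a bound uniform in \<open>y\<close>
  from a compact set is obtained from a weak form of monotonicity of \<open>g\<close>, inherited from \<open>f\<close>
  (\<open>shift_dominated_conv_power\<close>).\<close>

section \<open>Distributions on the half-line\<close>

definition nonneg_dist :: "real measure \<Rightarrow> bool" where
  "nonneg_dist \<mu> \<longleftrightarrow> real_distribution \<mu> \<and> measure \<mu> {0..} = 1"

lemma nonneg_dist_AE: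
  assumes "nonneg_dist \<mu>"
  shows "AE x in \<mu>. 0 \<le> x"
proof -
  interpret real_distribution \<mu> using assms by (simp add: nonneg_dist_def)
  show ?thesis
    using AE_prob_1[of "{0..}"] assms by (simp add: nonneg_dist_def)
qed

lemma nonneg_dist_convolution:
  assumes "nonneg_dist \<mu>" "nonneg_dist \<nu>"
  shows "nonneg_dist (\<mu> \<star> \<nu>)"
proof -
  interpret M: real_distribution \<mu> using assms by (simp add: nonneg_dist_def)
  interpret N: real_distribution \<nu> using assms by (simp add: nonneg_dist_def)
  interpret P: pair_prob_space \<mu> \<nu> ..
  have dist: "real_distribution (\<mu> \<star> \<nu>)"
    unfolding convolution_def by (rule P.real_distribution_distr) measurable
  interpret C: real_distribution "\<mu> \<star> \<nu>" by (rule dist)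
  have "AE x in \<mu>. AE y in \<nu>. 0 \<le> x + y"
    using nonneg_dist_AE[OF assms(1)]
  proof eventually_elim
    case (elim x)
    show ?case using nonneg_dist_AE[OF assms(2)] by eventually_elim (use elim in simp)
  qed
  moreover have "{p \<in> space (\<mu> \<Otimes>\<^sub>M \<nu>). 0 \<le> (case p of (x, y) \<Rightarrow> x + y)} \<in> sets (\<mu> \<Otimes>\<^sub>M \<nu>)"
    by measurable
  ultimately have "AE p in \<mu> \<Otimes>\<^sub>M \<nu>. 0 \<le> (case p of (x, y) \<Rightarrow> x + y)"
    by (intro P.AE_pair_measure) auto
  then have "AE z in \<mu> \<star> \<nu>. z \<in> {0..}"
    unfolding convolution_def by (subst AE_distr_iff) auto
  then show ?thesis
    using dist C.prob_eq_1[of "{0..}"] by (simp add: nonneg_dist_def)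
qed

lemma nonneg_dist_conv_power:
  assumes "nonneg_dist F"
  shows "nonneg_dist (conv_power F n)"
proof (induction n)
  case 0
  have "real_distribution (return borel (0::real))"
    by (simp add: real_distribution_def real_distribution_axioms_def prob_space_return)
  then show ?case by (simp add: nonneg_dist_def measure_return)
qed (simp add: nonneg_dist_convolution assms)

lemma measure_atMost_gt:
  assumes "nonneg_dist \<mu>" "\<epsilon> > 0"
  shows "\<forall>\<^sub>F A in at_top. 1 - \<epsilon> < measure \<mu> {..A}"
proof -
  interpret real_distribution \<mu> using assms by (simp add: nonneg_dist_def)
  show ?thesis
    using order_tendstoD(1)[OF cdf_lim_at_top_prob, of "1 - \<epsilon>"] assms(2) by (simp add: cdf_def2)
qed

lemma ivl_prob_nonneg: "0 \<le> ivl_prob c \<mu> x"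
  by (simp add: ivl_prob_def)

lemma ivl_prob_le_1:
  assumes "nonneg_dist \<mu>"
  shows "ivl_prob c \<mu> x \<le> 1"
proof -
  interpret real_distribution \<mu> using assms by (simp add: nonneg_dist_def)
  show ?thesis by (simp add: ivl_prob_def)
qed

lemma ivl_prob_measurable [measurable]:
  assumes "nonneg_dist \<mu>" "c > 0"
  shows "ivl_prob c \<mu> \<in> borel_measurable borel"
proof -
  interpret real_distribution \<mu> using assms by (simp add: nonneg_dist_def)
  have "mono (cdf \<mu>)" by (intro monoI cdf_nondecreasing)
  then have [measurable]: "cdf \<mu> \<in> borel_measurable borel" by (rule borel_measurable_mono)
  have "ivl_prob c \<mu> = (\<lambda>x. cdf \<mu> (x + c) - cdf \<mu> x)"
    using assms(2) by (simp add: fun_eq_iff ivl_prob_def cdf_diff_eq)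
  then show ?thesis by simp
qed

section \<open>Parts of a convolution\<close>

lemma sets_strip:
  fixes B :: "real set"
  assumes [measurable]: "B \<in> sets borel"
  shows "{p. fst p \<in> B \<and> x < fst p + snd p \<and> fst p + snd p \<le> x + c} \<in> sets (borel \<Otimes>\<^sub>M borel)"
    (is "?E1 \<in> _")
    and "{p. snd p \<in> B \<and> x < fst p + snd p \<and> fst p + snd p \<le> x + c} \<in> sets (borel \<Otimes>\<^sub>M borel)"
    (is "?E2 \<in> _")
proof -
  have "{p \<in> space (borel \<Otimes>\<^sub>M borel). p \<in> ?E1} \<in> sets (borel \<Otimes>\<^sub>M borel)"
    unfolding mem_Collect_eq by measurable
  then show "?E1 \<in> sets (borel \<Otimes>\<^sub>M borel)" by (simp add: space_pair_measure)
  have "{p \<in> space (borel \<Otimes>\<^sub>M borel). p \<in> ?E2} \<in> sets (borel \<Otimes>\<^sub>M borel)"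
    unfolding mem_Collect_eq by measurable
  then show "?E2 \<in> sets (borel \<Otimes>\<^sub>M borel)" by (simp add: space_pair_measure)
qed

text \<open>The contribution to \<open>(\<mu> \<star> \<nu>)((x, x + c])\<close> of the event that the \<open>\<mu>\<close>-distributed summand
  lies in \<open>B\<close>. As an integral over \<open>B\<close> it inherits pointwise bounds on the interval probabilities of
  \<open>\<nu>\<close>; as the probability of an event for a pair of independent summands it can be compared after
  the two summands are interchanged.\<close>

definition conv_part :: "real \<Rightarrow> real measure \<Rightarrow> real measure \<Rightarrow> real set \<Rightarrow> real \<Rightarrow> real" where
  "conv_part c \<mu> \<nu> B x = (\<integral>y. indicator B y * ivl_prob c \<nu> (x - y) \<partial>\<mu>)"

lemma conv_part_integrable:
  assumes "nonneg_dist \<mu>" "nonneg_dist \<nu>" "c > 0" "B \<in> sets borel"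
  shows "integrable \<mu> (\<lambda>y. indicator B y * ivl_prob c \<nu> (x - y))"
proof -
  interpret real_distribution \<mu> using assms by (simp add: nonneg_dist_def)
  note [measurable] = ivl_prob_measurable[OF assms(2,3)] assms(4)
  show ?thesis
    by (rule integrable_const_bound[where B = 1])
       (auto simp: indicator_def ivl_prob_nonneg ivl_prob_le_1[OF assms(2)])
qed

lemma conv_part_nonneg: "0 \<le> conv_part c \<mu> \<nu> B x"
  unfolding conv_part_def by (intro integral_nonneg_AE) (simp add: ivl_prob_nonneg)

lemma conv_part_eq_fst:
  assumes "nonneg_dist \<mu>" "nonneg_dist \<nu>" "c > 0" "B \<in> sets borel"
  shows "conv_part c \<mu> \<nu> B x =
    measure (\<mu> \<Otimes>\<^sub>M \<nu>) {p. fst p \<in> B \<and> x < fst p + snd p \<and> fst p + snd p \<le> x + c}"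
    (is "_ = measure _ ?E")
proof -
  interpret M: real_distribution \<mu> using assms by (simp add: nonneg_dist_def)
  interpret N: real_distribution \<nu> using assms by (simp add: nonneg_dist_def)
  have E: "?E \<in> sets (\<mu> \<Otimes>\<^sub>M \<nu>)"
    using sets_strip[OF assms(4)] by (simp cong: sets_pair_measure_cong)
  have slice: "emeasure \<nu> (Pair y -` ?E) = ennreal (indicator B y * ivl_prob c \<nu> (x - y))" for y
  proof -
    have "Pair y -` ?E = (if y \<in> B then {x - y<..x - y + c} else {})" by auto
    then show ?thesis by (simp add: ivl_prob_def N.emeasure_eq_measure)
  qed
  have "emeasure (\<mu> \<Otimes>\<^sub>M \<nu>) ?E = (\<integral>\<^sup>+y. ennreal (indicator B y * ivl_prob c \<nu> (x - y)) \<partial>\<mu>)"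
    by (simp only: N.emeasure_pair_measure_alt[OF E] slice)
  also have "\<dots> = ennreal (conv_part c \<mu> \<nu> B x)"
    unfolding conv_part_def
    by (intro nn_integral_eq_integral conv_part_integrable assms) (simp add: ivl_prob_nonneg)
  finally show ?thesis by (simp add: measure_def conv_part_nonneg)
qed

lemma conv_part_eq_snd:
  assumes "nonneg_dist \<mu>" "nonneg_dist \<nu>" "c > 0" "B \<in> sets borel"
  shows "conv_part c \<nu> \<mu> B x =
    measure (\<mu> \<Otimes>\<^sub>M \<nu>) {p. snd p \<in> B \<and> x < fst p + snd p \<and> fst p + snd p \<le> x + c}"
    (is "_ = measure _ ?E")
proof -
  interpret M: real_distribution \<mu> using assms by (simp add: nonneg_dist_def)
  interpret N: real_distribution \<nu> using assms by (simp add: nonneg_dist_def)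
  interpret P: pair_sigma_finite \<mu> \<nu> ..
  have E: "?E \<in> sets (\<mu> \<Otimes>\<^sub>M \<nu>)"
    using sets_strip[OF assms(4)] by (simp cong: sets_pair_measure_cong)
  have slice: "emeasure \<mu> ((\<lambda>y. (y, z)) -` ?E) = ennreal (indicator B z * ivl_prob c \<mu> (x - z))" for z
  proof -
    have "(\<lambda>y. (y, z)) -` ?E = (if z \<in> B then {x - z<..x - z + c} else {})" by auto
    then show ?thesis by (simp add: ivl_prob_def M.emeasure_eq_measure)
  qed
  have "emeasure (\<mu> \<Otimes>\<^sub>M \<nu>) ?E = (\<integral>\<^sup>+z. ennreal (indicator B z * ivl_prob c \<mu> (x - z)) \<partial>\<nu>)"
    by (simp only: P.emeasure_pair_measure_alt2[OF E] slice)
  also have "\<dots> = ennreal (conv_part c \<nu> \<mu> B x)"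
    unfolding conv_part_def
    by (intro nn_integral_eq_integral conv_part_integrable assms) (simp add: ivl_prob_nonneg)
  finally show ?thesis by (simp add: measure_def conv_part_nonneg)
qed

text \<open>Interchanging the roles of the summands: if the window \<open>x < y + z \<le> x + c\<close> and \<open>y \<in> B\<close> force
  \<open>z \<in> B'\<close>, one event contains the other.\<close>

lemma conv_part_swap_le:
  assumes "nonneg_dist \<mu>" "nonneg_dist \<nu>" "c > 0" "B \<in> sets borel" "B' \<in> sets borel"
    and sub: "\<And>y z. y \<in> B \<Longrightarrow> x < y + z \<Longrightarrow> y + z \<le> x + c \<Longrightarrow> z \<in> B'"
  shows "conv_part c \<mu> \<nu> B x \<le> conv_part c \<nu> \<mu> B' x"
proof -
  interpret M: real_distribution \<mu> using assms by (simp add: nonneg_dist_def)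
  interpret N: real_distribution \<nu> using assms by (simp add: nonneg_dist_def)
  interpret P: pair_prob_space \<mu> \<nu> ..
  show ?thesis
    unfolding conv_part_eq_fst[OF assms(1-4)] conv_part_eq_snd[OF assms(1-3,5)]
    by (rule P.finite_measure_mono)
       (use sets_strip(2)[OF assms(5)] in \<open>auto intro: sub cong: sets_pair_measure_cong\<close>)
qed

lemma conv_part_UNIV:
  assumes "nonneg_dist \<mu>" "nonneg_dist \<nu>" "c > 0"
  shows "conv_part c \<mu> \<nu> UNIV x = ivl_prob c (\<mu> \<star> \<nu>) x"
proof -
  interpret M: real_distribution \<mu> using assms by (simp add: nonneg_dist_def)
  interpret N: real_distribution \<nu> using assms by (simp add: nonneg_dist_def)
  have "ivl_prob c (\<mu> \<star> \<nu>) x =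
      measure (\<mu> \<Otimes>\<^sub>M \<nu>) ((\<lambda>(y, z). y + z) -` {x<..x + c} \<inter> space (\<mu> \<Otimes>\<^sub>M \<nu>))"
    unfolding ivl_prob_def convolution_def by (rule measure_distr) auto
  also have "(\<lambda>(y, z). y + z) -` {x<..x + c} \<inter> space (\<mu> \<Otimes>\<^sub>M \<nu>) =
      {p. fst p \<in> UNIV \<and> x < fst p + snd p \<and> fst p + snd p \<le> x + c}"
    by (auto simp: space_pair_measure)
  finally show ?thesis using conv_part_eq_fst[OF assms, of UNIV] by simp
qed

lemma conv_part_mono:
  assumes "nonneg_dist \<mu>" "nonneg_dist \<nu>" "nonneg_dist \<nu>'" "c > 0" "B \<in> sets borel"
    and le: "\<And>y. 0 \<le> y \<Longrightarrow> y \<in> B \<Longrightarrow> ivl_prob c \<nu> (x - y) \<le> C * ivl_prob c \<nu>' (x' - y)"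
  shows "conv_part c \<mu> \<nu> B x \<le> C * conv_part c \<mu> \<nu>' B x'"
proof -
  have "conv_part c \<mu> \<nu> B x \<le> (\<integral>y. C * (indicator B y * ivl_prob c \<nu>' (x' - y)) \<partial>\<mu>)"
    unfolding conv_part_def
  proof (rule integral_mono_AE)
    show "AE y in \<mu>. indicator B y * ivl_prob c \<nu> (x - y)
        \<le> C * (indicator B y * ivl_prob c \<nu>' (x' - y))"
      using nonneg_dist_AE[OF assms(1)] by eventually_elim (auto simp: indicator_def le)
  qed (use assms in \<open>auto intro!: conv_part_integrable\<close>)
  then show ?thesis by (simp add: conv_part_def)
qed

lemma conv_part_subset:
  assumes "nonneg_dist \<mu>" "nonneg_dist \<nu>" "c > 0" "B \<in> sets borel" "B' \<in> sets borel" "B \<subseteq> B'"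
  shows "conv_part c \<mu> \<nu> B x \<le> conv_part c \<mu> \<nu> B' x"
  unfolding conv_part_def
  by (intro integral_mono conv_part_integrable mult_right_mono assms ivl_prob_nonneg)
     (use assms(6) in \<open>auto simp: indicator_def\<close>)

lemma conv_part_ge_const:
  assumes "nonneg_dist \<mu>" "nonneg_dist \<nu>" "c > 0"
    and ge: "\<And>y. 0 \<le> y \<Longrightarrow> y \<le> A \<Longrightarrow> K \<le> ivl_prob c \<nu> (x - y)"
  shows "K * measure \<mu> {..A} \<le> conv_part c \<mu> \<nu> {..A} x"
proof -
  interpret real_distribution \<mu> using assms by (simp add: nonneg_dist_def)
  have "(\<integral>y. K * indicator {..A} y \<partial>\<mu>) \<le> conv_part c \<mu> \<nu> {..A} x"
    unfolding conv_part_def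
  proof (rule integral_mono_AE)
    show "AE y in \<mu>. K * indicator {..A} y \<le> indicator {..A} y * ivl_prob c \<nu> (x - y)"
      using nonneg_dist_AE[OF assms(1)] by eventually_elim (auto simp: indicator_def ge)
  qed (use assms in \<open>auto intro!: conv_part_integrable simp: emeasure_eq_measure\<close>)
  then show ?thesis by simp
qed

lemma conv_part_le_const:
  assumes "nonneg_dist \<mu>" "nonneg_dist \<nu>" "c > 0" "0 \<le> K"
    and le: "\<And>y. 0 \<le> y \<Longrightarrow> y \<le> A \<Longrightarrow> ivl_prob c \<nu> (x - y) \<le> K"
  shows "conv_part c \<mu> \<nu> {..A} x \<le> K"
proof -
  interpret real_distribution \<mu> using assms by (simp add: nonneg_dist_def)
  have "conv_part c \<mu> \<nu> {..A} x \<le> (\<integral>y. K \<partial>\<mu>)"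
    unfolding conv_part_def
  proof (rule integral_mono_AE)
    show "AE y in \<mu>. indicator {..A} y * ivl_prob c \<nu> (x - y) \<le> K"
      using nonneg_dist_AE[OF assms(1)] by eventually_elim (auto simp: indicator_def le assms(4))
  qed (use assms in \<open>auto intro!: conv_part_integrable\<close>)
  then show ?thesis using prob_space by simp
qed

lemma conv_part_le_convolution:
  assumes "nonneg_dist \<mu>" "nonneg_dist \<nu>" "c > 0" "B \<in> sets borel"
  shows "conv_part c \<mu> \<nu> B x \<le> ivl_prob c (\<mu> \<star> \<nu>) x"
    and "conv_part c \<nu> \<mu> B x \<le> ivl_prob c (\<mu> \<star> \<nu>) x"
  using conv_part_subset[of \<mu> \<nu> c B UNIV x] conv_part_swap_le[of \<nu> \<mu> c B UNIV x]
    conv_part_UNIV[of \<mu> \<nu> c x] assms by simp_all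

lemma ivl_prob_convolution_split:
  assumes "nonneg_dist \<mu>" "nonneg_dist \<nu>" "c > 0" "2 * A \<le> x"
  shows "ivl_prob c (\<mu> \<star> \<nu>) x =
    conv_part c \<mu> \<nu> {..A} x + conv_part c \<mu> \<nu> {A<..x - A} x + conv_part c \<mu> \<nu> {x - A<..} x"
proof -
  have "ivl_prob c (\<mu> \<star> \<nu>) x = (\<integral>y. indicator {..A} y * ivl_prob c \<nu> (x - y) +
      indicator {A<..x - A} y * ivl_prob c \<nu> (x - y) +
      indicator {x - A<..} y * ivl_prob c \<nu> (x - y) \<partial>\<mu>)"
    unfolding conv_part_UNIV[OF assms(1-3), symmetric] conv_part_def
    by (intro Bochner_Integration.integral_cong) (use assms(4) in \<open>auto simp: indicator_def\<close>)
  also have "\<dots> = conv_part c \<mu> \<nu> {..A} x + conv_part c \<mu> \<nu> {A<..x - A} x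
      + conv_part c \<mu> \<nu> {x - A<..} x"
    unfolding conv_part_def
    by (subst Bochner_Integration.integral_add Bochner_Integration.integrable_add;
        (intro Bochner_Integration.integrable_add conv_part_integrable assms)?; simp?)+
  finally show ?thesis .
qed

text \<open>If the first summand exceeds \<open>x - A\<close>, the second one is smaller than \<open>A + c\<close>; conversely a
  second summand of size at most \<open>A\<close> forces the first one above \<open>x - A\<close>. This is why the two bounds
  below differ by \<open>c\<close> in the last term.\<close>

lemma ivl_prob_convolution_le:
  assumes "nonneg_dist \<mu>" "nonneg_dist \<nu>" "c > 0" "2 * A \<le> x"
  shows "ivl_prob c (\<mu> \<star> \<nu>) x \<le>
    conv_part c \<mu> \<nu> {..A} x + conv_part c \<mu> \<nu> {A<..x - A} x + conv_part c \<nu> \<mu> {..A + c} x"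
  using ivl_prob_convolution_split[OF assms]
    conv_part_swap_le[OF assms(1-3), of "{x - A<..}" "{..A + c}" x] by auto

lemma ivl_prob_convolution_ge:
  assumes "nonneg_dist \<mu>" "nonneg_dist \<nu>" "c > 0" "2 * A \<le> x"
  shows "conv_part c \<mu> \<nu> {..A} x + conv_part c \<mu> \<nu> {A<..x - A} x + conv_part c \<nu> \<mu> {..A} x
    \<le> ivl_prob c (\<mu> \<star> \<nu>) x"
  using ivl_prob_convolution_split[OF assms]
    conv_part_swap_le[OF assms(2,1,3), of "{..A}" "{x - A<..}" x] by auto

section \<open>Asymptotic equivalence, monotonicity and long tails\<close>

lemma asymp_equiv_eventually_bounds:
  fixes \<phi> \<psi> :: "real \<Rightarrow> real"
  assumes "\<phi> \<sim>[at_top] \<psi>" "\<forall>\<^sub>F x in at_top. 0 < \<psi> x" "\<epsilon> > 0"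
  shows "\<forall>\<^sub>F x in at_top. (1 - \<epsilon>) * \<psi> x \<le> \<phi> x \<and> \<phi> x \<le> (1 + \<epsilon>) * \<psi> x"
proof -
  have "\<forall>\<^sub>F x in at_top. dist (if \<phi> x = 0 \<and> \<psi> x = 0 then 1 else \<phi> x / \<psi> x) 1 < \<epsilon>"
    using tendstoD[OF asymp_equivD[OF assms(1)] assms(3)] .
  then show ?thesis
    using assms(2)
  proof eventually_elim
    case (elim x)
    then have "\<bar>\<phi> x / \<psi> x - 1\<bar> < \<epsilon>" by (simp add: dist_real_def)
    then have "1 - \<epsilon> < \<phi> x / \<psi> x" "\<phi> x / \<psi> x < 1 + \<epsilon>" by linarith+
    then show ?case using elim(2) by (simp add: field_simps)
  qed
qed

lemma asymp_equivI_eventually_bounds: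
  fixes \<phi> \<psi> :: "real \<Rightarrow> real"
  assumes pos: "\<forall>\<^sub>F x in at_top. 0 < \<psi> x"
    and lower: "\<And>\<epsilon>. 0 < \<epsilon> \<Longrightarrow> \<forall>\<^sub>F x in at_top. (1 - \<epsilon>) * \<psi> x \<le> \<phi> x"
    and upper: "\<And>\<epsilon>. 0 < \<epsilon> \<Longrightarrow> \<forall>\<^sub>F x in at_top. \<phi> x \<le> (1 + \<epsilon>) * \<psi> x"
  shows "\<phi> \<sim>[at_top] \<psi>"
proof (rule asymp_equivI', rule tendstoI)
  fix e :: real assume "e > 0"
  then have e2: "e / 2 > 0" by simp
  show "\<forall>\<^sub>F x in at_top. dist (\<phi> x / \<psi> x) 1 < e"
    using pos lower[OF e2] upper[OF e2]
  proof eventually_elim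
    case (elim x)
    then have "1 - e / 2 \<le> \<phi> x / \<psi> x" "\<phi> x / \<psi> x \<le> 1 + e / 2"
      by (simp_all add: pos_le_divide_eq pos_divide_le_eq)
    then show ?case using \<open>e > 0\<close> unfolding dist_real_def by linarith
  qed
qed

text \<open>The half of \<open>asymp_nonincreasing\<close> that drives the argument: large arguments are compared at
  arbitrary distance, with a factor arbitrarily close to \<open>1\<close>.\<close>

definition almost_decreasing :: "(real \<Rightarrow> real) \<Rightarrow> bool" where
  "almost_decreasing \<phi> \<longleftrightarrow>
    (\<forall>\<epsilon>>0. \<exists>x0. \<forall>s t. x0 \<le> s \<longrightarrow> s \<le> t \<longrightarrow> \<phi> t \<le> (1 + \<epsilon>) * \<phi> s)"

lemma asymp_nonincreasing_eventually_pos: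
  assumes "asymp_nonincreasing \<phi>"
  shows "\<forall>\<^sub>F x in at_top. 0 < \<phi> x"
proof -
  obtain x0 where "\<forall>x\<ge>x0. 0 < \<phi> x"
    using assms unfolding asymp_nonincreasing_def by (elim conjE exE) (rule that)
  then show ?thesis unfolding eventually_at_top_linorder by auto
qed

lemma asymp_nonincreasing_almost_decreasing:
  assumes "asymp_nonincreasing \<phi>"
  shows "almost_decreasing \<phi>"
  unfolding almost_decreasing_def
proof (intro allI impI)
  fix \<epsilon> :: real assume "\<epsilon> > 0"
  have bdd: "\<forall>\<^sub>F x in at_top. bdd_above (\<phi> ` {x..})"
    using assms unfolding asymp_nonincreasing_def by (elim conjE exE)
  have sup: "(\<lambda>x. SUP t\<in>{x..}. \<phi> t) \<sim>[at_top] \<phi>"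
    using assms unfolding asymp_nonincreasing_def by (elim conjE exE)
  from bdd asymp_equiv_eventually_bounds[OF sup
      asymp_nonincreasing_eventually_pos[OF assms] \<open>\<epsilon> > 0\<close>]
  have "\<forall>\<^sub>F s in at_top. bdd_above (\<phi> ` {s..}) \<and> (SUP t\<in>{s..}. \<phi> t) \<le> (1 + \<epsilon>) * \<phi> s"
    by eventually_elim simp
  then obtain x0 where x0: "\<forall>s\<ge>x0. bdd_above (\<phi> ` {s..}) \<and> (SUP t\<in>{s..}. \<phi> t) \<le> (1 + \<epsilon>) * \<phi> s"
    unfolding eventually_at_top_linorder by (elim exE) (rule that)
  show "\<exists>x0. \<forall>s t. x0 \<le> s \<longrightarrow> s \<le> t \<longrightarrow> \<phi> t \<le> (1 + \<epsilon>) * \<phi> s"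
  proof (intro exI allI impI)
    fix s t assume "x0 \<le> s" "s \<le> t"
    then have "\<phi> t \<le> (SUP t\<in>{s..}. \<phi> t)"
      using x0 by (intro cSUP_upper) auto
    also have "\<dots> \<le> (1 + \<epsilon>) * \<phi> s" using x0 \<open>x0 \<le> s\<close> by simp
    finally show "\<phi> t \<le> (1 + \<epsilon>) * \<phi> s" .
  qed
qed

text \<open>A substitute for monotonicity that survives convolution, at the price of a larger constant \<open>C\<close>
  and of comparing only arguments at bounded distance. The constant is chosen before the
  distance \<open>B\<close> because \<open>conv_power_le\<close> fixes its error terms in terms of \<open>C\<close> before it knows how far it has
  to shift.\<close>

definition shift_dominated :: "real \<Rightarrow> (real \<Rightarrow> real) \<Rightarrow> bool" where
  "shift_dominated C \<phi> \<longleftrightarrow>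
    (\<forall>B. \<exists>x0. \<forall>x y. x0 \<le> x \<longrightarrow> 0 \<le> y \<longrightarrow> y \<le> B \<longrightarrow> \<phi> x \<le> C * \<phi> (x - y))"

lemma almost_decreasing_shift_dominated:
  assumes "almost_decreasing \<phi>"
  shows "shift_dominated 2 \<phi>"
  unfolding shift_dominated_def
proof
  fix B :: real
  obtain x0 where x0: "\<And>s t. x0 \<le> s \<Longrightarrow> s \<le> t \<Longrightarrow> \<phi> t \<le> 2 * \<phi> s"
    using assms unfolding almost_decreasing_def by (metis one_add_one zero_less_one)
  show "\<exists>x0. \<forall>x y. x0 \<le> x \<longrightarrow> 0 \<le> y \<longrightarrow> y \<le> B \<longrightarrow> \<phi> x \<le> 2 * \<phi> (x - y)"
    by (rule exI[of _ "x0 + B"]) (auto intro!: x0)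
qed

text \<open>Of two summands with sum beyond \<open>x\<close>, one is at least about \<open>x / 2\<close>. Conditioning on the other
  summand, this large summand lies far out, where its distribution may be shifted by \<open>y\<close>; the cut is
  at \<open>x / 2\<close>, which makes the middle part of the decomposition empty.\<close>

lemma shift_dominated_convolution:
  assumes "nonneg_dist \<mu>" "nonneg_dist \<nu>" "c > 0" "0 \<le> C" "0 \<le> D"
    and "shift_dominated C (ivl_prob c \<mu>)" "shift_dominated D (ivl_prob c \<nu>)"
  shows "shift_dominated (C + D) (ivl_prob c (\<mu> \<star> \<nu>))"
  unfolding shift_dominated_def
proof
  fix B :: real
  obtain x1 where x1: "\<And>x y. x1 \<le> x \<Longrightarrow> 0 \<le> y \<Longrightarrow> y \<le> B \<Longrightarrow>
      ivl_prob c \<mu> x \<le> C * ivl_prob c \<mu> (x - y)"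
    using assms(6) unfolding shift_dominated_def by blast
  obtain x2 where x2: "\<And>x y. x2 \<le> x \<Longrightarrow> 0 \<le> y \<Longrightarrow> y \<le> B \<Longrightarrow>
      ivl_prob c \<nu> x \<le> D * ivl_prob c \<nu> (x - y)"
    using assms(7) unfolding shift_dominated_def by blast
  have "ivl_prob c (\<mu> \<star> \<nu>) x \<le> (C + D) * ivl_prob c (\<mu> \<star> \<nu>) (x - y)"
    if x: "max (2 * (x1 + c)) (2 * x2) \<le> x" and y: "0 \<le> y" "y \<le> B" for x y
  proof -
    have "ivl_prob c (\<mu> \<star> \<nu>) x \<le>
        conv_part c \<mu> \<nu> {..x / 2} x + conv_part c \<mu> \<nu> {x / 2<..x - x / 2} x
        + conv_part c \<nu> \<mu> {..x / 2 + c} x"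
      using ivl_prob_convolution_le[OF assms(1-3), of "x / 2" x] by simp
    also have "conv_part c \<mu> \<nu> {x / 2<..x - x / 2} x = 0"
      by (simp add: conv_part_def)
    also have "conv_part c \<mu> \<nu> {..x / 2} x \<le> D * conv_part c \<mu> \<nu> {..x / 2} (x - y)"
    proof (rule conv_part_mono[OF assms(1,2,2,3)])
      fix z assume "0 \<le> z" "z \<in> {..x / 2}"
      then show "ivl_prob c \<nu> (x - z) \<le> D * ivl_prob c \<nu> (x - y - z)"
        using x2[of "x - z" y] x y by (simp add: algebra_simps)
    qed simp
    also have "\<dots> \<le> D * ivl_prob c (\<mu> \<star> \<nu>) (x - y)"
      by (intro mult_left_mono conv_part_le_convolution assms) simp
    also have "conv_part c \<nu> \<mu> {..x / 2 + c} x \<le> C * conv_part c \<nu> \<mu> {..x / 2 + c} (x - y)"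
    proof (rule conv_part_mono[OF assms(2,1,1,3)])
      fix z assume "0 \<le> z" "z \<in> {..x / 2 + c}"
      then show "ivl_prob c \<mu> (x - z) \<le> C * ivl_prob c \<mu> (x - y - z)"
        using x1[of "x - z" y] x y by (simp add: algebra_simps)
    qed simp
    also have "\<dots> \<le> C * ivl_prob c (\<mu> \<star> \<nu>) (x - y)"
      by (intro mult_left_mono conv_part_le_convolution assms) simp
    finally show ?thesis by (simp add: algebra_simps)
  qed
  then show "\<exists>x0. \<forall>x y. x0 \<le> x \<longrightarrow> 0 \<le> y \<longrightarrow> y \<le> B \<longrightarrow>
      ivl_prob c (\<mu> \<star> \<nu>) x \<le> (C + D) * ivl_prob c (\<mu> \<star> \<nu>) (x - y)"
    by blast
qed

lemma shift_dominated_conv_power: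
  assumes "nonneg_dist F" "c > 0" "shift_dominated 2 (ivl_prob c F)" "1 \<le> n"
  shows "shift_dominated (2 * n) (ivl_prob c (conv_power F n))"
  using assms(4)
proof (induction n rule: dec_induct)
  case base
  then show ?case using assms conv_power_1[of F] by (simp add: nonneg_dist_def)
next
  case (step n)
  have "shift_dominated (2 + 2 * real n) (ivl_prob c (F \<star> conv_power F n))"
    using assms by (intro shift_dominated_convolution nonneg_dist_conv_power step.IH) auto
  moreover have "2 + 2 * real n = 2 * real (Suc n)" by simp
  ultimately show ?case by (simp only: conv_power.simps)
qed

lemma class_L_eventually_pos:
  assumes "\<phi> \<in> class_L"
  shows "\<forall>\<^sub>F x in at_top. 0 < \<phi> x"
proof -
  obtain x0 where "\<forall>x\<ge>x0. 0 < \<phi> x"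
    using assms unfolding class_L_def by auto
  then show ?thesis unfolding eventually_at_top_linorder by auto
qed

lemma class_L_shift_back:
  assumes "\<phi> \<in> class_L" "\<epsilon> > 0" "T \<ge> 0"
  shows "\<forall>\<^sub>F x in at_top. \<phi> (x - T) \<le> (1 + \<epsilon>) * \<phi> x"
    and "\<forall>\<^sub>F x in at_top. (1 - \<epsilon>) * \<phi> x \<le> \<phi> (x - T)"
proof -
  have pos: "\<forall>\<^sub>F x in at_top. 0 < \<phi> x"
    using assms(1) by (rule class_L_eventually_pos)
  have "\<phi> \<sim>[at_top] (\<lambda>x. \<phi> (x - T))"
  proof (cases "T = 0")
    case False
    then have "(\<lambda>x. \<phi> (x + T)) \<sim>[at_top] \<phi>"
      using assms unfolding class_L_def by simp
    then have "(\<lambda>x. \<phi> (x - T + T)) \<sim>[at_top] (\<lambda>x. \<phi> (x - T))"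
      by (rule asymp_equiv_compose'[where f = "\<lambda>x. \<phi> (x + T)"]) real_asymp
    then show ?thesis by simp
  qed simp
  then have eq: "(\<lambda>x. \<phi> (x - T)) \<sim>[at_top] \<phi>" by (rule asymp_equiv_symI)
  show "\<forall>\<^sub>F x in at_top. \<phi> (x - T) \<le> (1 + \<epsilon>) * \<phi> x"
    using asymp_equiv_eventually_bounds[OF eq pos assms(2)] by eventually_elim simp
  show "\<forall>\<^sub>F x in at_top. (1 - \<epsilon>) * \<phi> x \<le> \<phi> (x - T)"
    using asymp_equiv_eventually_bounds[OF eq pos assms(2)] by eventually_elim simp
qed

text \<open>Convergence of \<open>\<phi> (x - y) / \<phi> x\<close> is only assumed for each \<open>y\<close> separately. A bound that is uniform
  for \<open>y \<in> [0, A]\<close> comes from shifting all of these points to the single point \<open>x - A\<close>.\<close>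

lemma class_L_locally_bounded_ratio:
  assumes "\<phi> \<in> class_L" "shift_dominated C \<phi>" "0 \<le> C"
  shows "\<forall>\<^sub>F x in at_top. \<forall>y. 0 \<le> y \<longrightarrow> y \<le> A \<longrightarrow> \<phi> (x - y) \<le> 2 * C * \<phi> x"
proof (cases "A \<ge> 0")
  case True
  obtain x0 where x0: "\<And>x y. x0 \<le> x \<Longrightarrow> 0 \<le> y \<Longrightarrow> y \<le> A \<Longrightarrow> \<phi> x \<le> C * \<phi> (x - y)"
    using assms(2) unfolding shift_dominated_def by blast
  show ?thesis
    using class_L_shift_back(1)[OF assms(1) zero_less_one True] eventually_ge_at_top[of "x0 + A"]
  proof eventually_elim
    case (elim x)
    have "\<phi> (x - y) \<le> 2 * C * \<phi> x" if "0 \<le> y" "y \<le> A" for y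
    proof -
      have "\<phi> (x - y) \<le> C * \<phi> (x - A)"
        using x0[of "x - y" "A - y"] that elim by simp
      also have "\<dots> \<le> C * ((1 + 1) * \<phi> x)"
        using elim assms(3) by (intro mult_left_mono) auto
      finally show ?thesis by simp
    qed
    then show ?case by blast
  qed
qed auto

section \<open>Negligible contributions of two large summands\<close>

text \<open>By dominated convergence, each of the two events that one summand is at most \<open>A\<close> contributes
  about \<open>G((-\<infinity>, A])\<close> times the interval probability of \<open>G\<close>. For large \<open>A\<close> both together
  exhaust the asymptotic value \<open>2\<close>, and nothing is left for two summands above \<open>A\<close>.\<close>

lemma S_Delta_middle_negligible:
  assumes G: "nonneg_dist G" "c > 0" "G \<in> S_Delta c"
    and dom: "shift_dominated C (ivl_prob c G)" "0 \<le> C"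
    and "\<epsilon> > 0"
  shows "\<forall>\<^sub>F A in at_top. \<forall>\<^sub>F x in at_top.
    conv_part c G G {A<..x - A} x \<le> \<epsilon> * ivl_prob c G x"
proof -
  interpret real_distribution G using G by (simp add: nonneg_dist_def)
  let ?g = "ivl_prob c G"
  have L: "?g \<in> class_L" and two: "ivl_prob c (conv_power G 2) \<sim>[at_top] (\<lambda>x. 2 * ?g x)"
    using G(3) by (auto simp: S_Delta_def L_Delta_def)
  have pos: "\<forall>\<^sub>F x in at_top. 0 < ?g x"
    using L by (rule class_L_eventually_pos)
  note [measurable] = ivl_prob_measurable[OF G(1,2)]
  have lim: "((\<lambda>x. conv_part c G G {..A} x / ?g x) \<longlongrightarrow> measure G {..A}) at_top" for A
  proof -
    have "((\<lambda>x. \<integral>y. indicator {..A} y * ?g (x - y) / ?g x \<partial>G) \<longlongrightarrow> (\<integral>y. indicator {..A} y \<partial>G)) at_top"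
    proof (rule integral_dominated_convergence_at_top[where w = "\<lambda>_. 2 * C"])
      show "\<forall>\<^sub>F x in at_top. AE y in G. norm (indicator {..A} y * ?g (x - y) / ?g x) \<le> 2 * C"
        using class_L_locally_bounded_ratio[OF L dom, of A] pos
      proof eventually_elim
        case (elim x)
        show ?case
          using nonneg_dist_AE[OF G(1)]
        proof eventually_elim
          case (elim y)
          then show ?case
            using \<open>\<forall>y. 0 \<le> y \<longrightarrow> y \<le> A \<longrightarrow> ?g (x - y) \<le> 2 * C * ?g x\<close> \<open>0 < ?g x\<close> dom(2)
            by (auto simp: indicator_def ivl_prob_nonneg pos_divide_le_eq)
        qed
      qed
      show "AE y in G. ((\<lambda>x. indicator {..A} y * ?g (x - y) / ?g x) \<longlongrightarrow> indicator {..A} y) at_top"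
        using nonneg_dist_AE[OF G(1)]
      proof eventually_elim
        case (elim y)
        have "((\<lambda>x. ?g (x - y) / ?g x) \<longlongrightarrow> 1) at_top"
        proof (rule tendstoI)
          fix e :: real assume "e > 0"
          then have "e / 2 > 0" by simp
          from class_L_shift_back[OF L this elim] pos
          show "\<forall>\<^sub>F x in at_top. dist (?g (x - y) / ?g x) 1 < e"
          proof eventually_elim
            case (elim x)
            then have "1 - e / 2 \<le> ?g (x - y) / ?g x" "?g (x - y) / ?g x \<le> 1 + e / 2"
              by (simp_all add: pos_le_divide_eq pos_divide_le_eq)
            then show ?case using \<open>e > 0\<close> unfolding dist_real_def by linarith
          qed
        qed
        then show ?case by (auto simp: indicator_def)
      qed
    qed auto
    then show ?thesis by (simp add: conv_part_def)
  qed
  have "\<epsilon> / 8 > 0" "\<epsilon> / 4 > 0" using \<open>\<epsilon> > 0\<close> by auto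
  from measure_atMost_gt[OF G(1) this(2)] show ?thesis
  proof eventually_elim
    case (elim A)
    have pos2: "\<forall>\<^sub>F x in at_top. 0 < 2 * ?g x" using pos by eventually_elim simp
    have "\<forall>\<^sub>F x in at_top. 1 - \<epsilon> / 4 < conv_part c G G {..A} x / ?g x"
      by (rule order_tendstoD(1)[OF lim elim])
    then show ?case
      using asymp_equiv_eventually_bounds[OF two pos2 \<open>\<epsilon> / 8 > 0\<close>] pos
        eventually_ge_at_top[of "2 * A"]
    proof eventually_elim
      case (elim x)
      have "(1 - \<epsilon> / 4) * ?g x \<le> conv_part c G G {..A} x"
        using elim by (simp add: field_simps)
      moreover have "ivl_prob c (conv_power G 2) x = ivl_prob c (G \<star> G) x"
        using conv_power_2[of G] G(1) by (simp add: nonneg_dist_def)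
      ultimately have "conv_part c G G {A<..x - A} x \<le> (1 + \<epsilon> / 8) * (2 * ?g x) - 2 * ((1 - \<epsilon> / 4) * ?g x)"
        using ivl_prob_convolution_ge[OF G(1,1,2), of A x] elim by linarith
      also have "\<dots> \<le> \<epsilon> * ?g x"
        using elim by (simp add: algebra_simps)
      finally show ?case .
    qed
  qed
qed

section \<open>Convolution powers against a single summand\<close>

text \<open>One summand makes the sum large while the others stay bounded; there are \<open>n\<close> disjoint ways to do
  this, and almost monotonicity allows the large summand to be moved to \<open>x\<close>. The induction separates
  one summand from the remaining \<open>n\<close>.\<close>

lemma conv_power_ge:
  assumes F: "nonneg_dist F" "c > 0" "almost_decreasing (ivl_prob c F)"
    and "1 \<le> n" "\<epsilon> > 0"
  shows "\<forall>\<^sub>F x in at_top. (n - \<epsilon>) * ivl_prob c F x \<le> ivl_prob c (conv_power F n) x"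
  using assms(4,5)
proof (induction n arbitrary: \<epsilon> rule: dec_induct)
  case base
  have F1: "conv_power F 1 = F"
    using F(1) by (intro conv_power_1) (simp add: nonneg_dist_def)
  have "(1 - \<epsilon>) * ivl_prob c F x \<le> ivl_prob c F x" for x
    using base ivl_prob_nonneg[of c F x] by (simp add: left_diff_distrib)
  then show ?case unfolding F1 by simp
next
  case (step n)
  let ?f = "ivl_prob c F" and ?h = "ivl_prob c (conv_power F n)"
  have H: "nonneg_dist (conv_power F n)" by (rule nonneg_dist_conv_power[OF F(1)])
  \<comment> \<open>With this choice \<open>(n + 1 - \<delta>) * (1 - \<delta>)\<^sup>2 \<ge> n + 1 - \<epsilon>\<close>.\<close>
  define \<delta> where "\<delta> = min 1 (\<epsilon> / (2 * n + 3))"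
  have "0 < \<delta>" "\<delta> \<le> 1" "\<delta> \<le> \<epsilon> / (2 * n + 3)"
    using step.prems by (simp_all add: \<delta>_def)
  then have \<delta>: "0 < \<delta>" "\<delta> \<le> 1" "(2 * n + 3) * \<delta> \<le> \<epsilon>"
    by (simp_all add: pos_le_divide_eq mult.commute)
  obtain x1 where x1: "\<And>s t. x1 \<le> s \<Longrightarrow> s \<le> t \<Longrightarrow> ?f t \<le> (1 + \<delta>) * ?f s"
    using F(3) \<delta>(1) unfolding almost_decreasing_def by metis
  have dec: "(1 - \<delta>) * ?f t \<le> ?f s" if "x1 \<le> s" "s \<le> t" for s t
  proof -
    have "(1 - \<delta>) * ?f t \<le> (1 - \<delta>) * ((1 + \<delta>) * ?f s)"
      using \<delta> by (intro mult_left_mono x1 that) simp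
    also have "\<dots> = ?f s - \<delta>\<^sup>2 * ?f s"
      by (simp add: algebra_simps power2_eq_square)
    also have "\<dots> \<le> ?f s" by (simp add: ivl_prob_nonneg)
    finally show ?thesis .
  qed
  obtain x2 where x2: "\<And>x. x2 \<le> x \<Longrightarrow> (n - \<delta>) * ?f x \<le> ?h x"
    using step.IH[OF \<delta>(1)] unfolding eventually_at_top_linorder by auto
  obtain A where A: "1 - \<delta> < measure F {..A}" "1 - \<delta> < measure (conv_power F n) {..A}"
    using eventually_happens'[OF _ eventually_conj[OF measure_atMost_gt[OF F(1) \<delta>(1)]
        measure_atMost_gt[OF H \<delta>(1)]]] by auto
  have n: "1 \<le> real n" using step.hyps by simp
  show ?case
    using eventually_ge_at_top[of "2 * A"] eventually_ge_at_top[of "max x1 x2 + A"]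
  proof eventually_elim
    case (elim x)
    have "(n - \<delta>) * ((1 - \<delta>) * ?f x) * (1 - \<delta>) \<le> (n - \<delta>) * ((1 - \<delta>) * ?f x) * measure F {..A}"
      using \<delta> A n by (intro mult_left_mono) (auto simp: ivl_prob_nonneg)
    also have "\<dots> \<le> conv_part c F (conv_power F n) {..A} x"
    proof (rule conv_part_ge_const[OF F(1) H F(2)])
      fix y assume y: "0 \<le> y" "y \<le> A"
      have "(n - \<delta>) * ((1 - \<delta>) * ?f x) \<le> (n - \<delta>) * ?f (x - y)"
        using \<delta> n y elim by (intro mult_left_mono dec) auto
      also have "\<dots> \<le> ?h (x - y)" using y elim by (intro x2) auto
      finally show "(n - \<delta>) * ((1 - \<delta>) * ?f x) \<le> ?h (x - y)" .
    qed
    finally have first: "(n - \<delta>) * ((1 - \<delta>) * ?f x) * (1 - \<delta>) \<le> conv_part c F (conv_power F n) {..A} x" .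
    have "(1 - \<delta>) * ?f x * (1 - \<delta>) \<le> (1 - \<delta>) * ?f x * measure (conv_power F n) {..A}"
      using \<delta> A n by (intro mult_left_mono) (auto simp: ivl_prob_nonneg)
    also have "\<dots> \<le> conv_part c (conv_power F n) F {..A} x"
      using elim by (intro conv_part_ge_const[OF H F(1,2)] dec) auto
    finally have second: "(1 - \<delta>) * ?f x * (1 - \<delta>) \<le> conv_part c (conv_power F n) F {..A} x" .
    have "0 \<le> \<delta> * (2 * \<delta> + (n + 1 - \<delta>) * \<delta>)"
      using \<delta> n by (intro mult_nonneg_nonneg add_nonneg_nonneg) auto
    then have "real (Suc n) - (2 * n + 3) * \<delta> \<le> (n - \<delta>) * (1 - \<delta>) * (1 - \<delta>) + (1 - \<delta>) * (1 - \<delta>)"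
      by (simp add: algebra_simps)
    then have "real (Suc n) - \<epsilon> \<le> (n - \<delta>) * (1 - \<delta>) * (1 - \<delta>) + (1 - \<delta>) * (1 - \<delta>)"
      using \<delta>(3) by linarith
    then have "(real (Suc n) - \<epsilon>) * ?f x \<le>
        ((n - \<delta>) * (1 - \<delta>) * (1 - \<delta>) + (1 - \<delta>) * (1 - \<delta>)) * ?f x"
      by (intro mult_right_mono ivl_prob_nonneg)
    also have "\<dots> = (n - \<delta>) * ((1 - \<delta>) * ?f x) * (1 - \<delta>) + (1 - \<delta>) * ?f x * (1 - \<delta>)"
      by (simp add: distrib_right)
    also have "\<dots> \<le> ivl_prob c (F \<star> conv_power F n) x"
      using first second ivl_prob_convolution_ge[OF F(1) H F(2), of A x] elim
        conv_part_nonneg[of c F "conv_power F n" "{A<..x - A}" x] by linarith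
    finally show ?case by simp
  qed
qed

text \<open>Replace \<open>\<nu>\<close> by \<open>G\<close>, interchange the summands, and replace \<open>\<mu>\<close> by \<open>G\<close>. The middle part only
  involves values at arguments of at least about \<open>A\<close>, which is why tail domination suffices once \<open>A\<close>
  is large.\<close>

lemma middle_negligible_dominated:
  assumes "nonneg_dist \<mu>" "nonneg_dist \<nu>" "nonneg_dist G" "c > 0" "C > 0"
    and dom: "\<forall>\<^sub>F x in at_top. ivl_prob c \<mu> x \<le> C * ivl_prob c G x"
      "\<forall>\<^sub>F x in at_top. ivl_prob c \<nu> x \<le> C * ivl_prob c G x"
    and middle: "\<And>\<epsilon>. 0 < \<epsilon> \<Longrightarrow> \<forall>\<^sub>F A in at_top. \<forall>\<^sub>F x in at_top.
      conv_part c G G {A<..x - A} x \<le> \<epsilon> * ivl_prob c G x"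
    and "\<epsilon> > 0"
  shows "\<forall>\<^sub>F A in at_top. \<forall>\<^sub>F x in at_top.
    conv_part c \<mu> \<nu> {A<..x - A} x \<le> \<epsilon> * ivl_prob c G x"
proof -
  obtain u where u: "\<And>x. u \<le> x \<Longrightarrow> ivl_prob c \<mu> x \<le> C * ivl_prob c G x"
      "\<And>x. u \<le> x \<Longrightarrow> ivl_prob c \<nu> x \<le> C * ivl_prob c G x"
    using eventually_conj[OF dom] unfolding eventually_at_top_linorder by auto
  have "\<epsilon> / (C * C) > 0" using assms(5,9) by simp
  from middle[OF this, THEN iffD1[OF eventually_at_top_linorder]]
  obtain A1 where A1: "\<And>A. A1 \<le> A \<Longrightarrow> \<forall>\<^sub>F x in at_top.
      conv_part c G G {A<..x - A} x \<le> \<epsilon> / (C * C) * ivl_prob c G x"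
    by blast
  show ?thesis
    using eventually_ge_at_top[of "max A1 u + c"]
  proof eventually_elim
    case (elim A)
    \<comment> \<open>If the first summand exceeds \<open>A\<close>, the second one may still exceed \<open>x - A\<close>, by less than \<open>c\<close>.\<close>
    define A' where "A' = A - c"
    have A': "A1 \<le> A'" "u \<le> A'" "u \<le> A" "A' + c = A"
      using elim assms(4) by (auto simp: A'_def)
    show ?case
      using A1[OF A'(1)]
    proof eventually_elim
      case (elim x)
      have "conv_part c \<mu> \<nu> {A<..x - A} x \<le> C * conv_part c \<mu> G {A<..x - A} x"
        using A' by (intro conv_part_mono assms u) auto
      also have "\<dots> \<le> C * conv_part c G \<mu> {A'<..x - A'} x"
        using A' assms(4,5) by (intro mult_left_mono conv_part_swap_le assms) auto
      also have "\<dots> \<le> C * (C * conv_part c G G {A'<..x - A'} x)"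
        using A' assms(5) by (intro mult_left_mono conv_part_mono assms u) auto
      also have "\<dots> \<le> C * (C * (\<epsilon> / (C * C) * ivl_prob c G x))"
        using elim assms(5) by (intro mult_left_mono) auto
      also have "\<dots> = \<epsilon> * ivl_prob c G x" using assms(5) by simp
      finally show ?case .
    qed
  qed
qed

text \<open>The upper bound has a shift \<open>T\<close>, since moving the large summand from \<open>x\<close> back to \<open>x - T\<close> is the
  direction in which almost monotonicity gives an upper bound; that \<open>f\<close> is long-tailed is
  unknown at this stage. The error is measured by \<open>G\<close>, which is long-tailed. The induction hypothesis
  itself shows that the \<open>n\<close>-th power is dominated by \<open>G\<close>, so that the part with two large summands is
  negligible with respect to \<open>G\<close>.\<close>

lemma conv_power_le:
  assumes F: "nonneg_dist F" "c > 0" "almost_decreasing (ivl_prob c F)"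
    and G: "nonneg_dist G" "ivl_prob c G \<in> class_L"
      "shift_dominated C (ivl_prob c G)" "0 \<le> C"
    and dom: "\<forall>\<^sub>F x in at_top. ivl_prob c F x \<le> 2 * ivl_prob c G x"
    and middle: "\<And>\<epsilon>. 0 < \<epsilon> \<Longrightarrow> \<forall>\<^sub>F A in at_top. \<forall>\<^sub>F x in at_top.
      conv_part c G G {A<..x - A} x \<le> \<epsilon> * ivl_prob c G x"
    and "1 \<le> n" "\<epsilon> > 0"
  shows "\<exists>T\<ge>0. \<forall>\<^sub>F x in at_top.
    ivl_prob c (conv_power F n) x \<le> (n + \<epsilon>) * ivl_prob c F (x - T) + \<epsilon> * ivl_prob c G x"
  using assms(10,11)
proof (induction n arbitrary: \<epsilon> rule: dec_induct)
  case base
  have F1: "conv_power F 1 = F"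
    using F(1) by (intro conv_power_1) (simp add: nonneg_dist_def)
  have "ivl_prob c F x \<le> (1 + \<epsilon>) * ivl_prob c F (x - 0) + \<epsilon> * ivl_prob c G x" for x
    using base ivl_prob_nonneg[of c F x] ivl_prob_nonneg[of c G x] by (simp add: algebra_simps)
  then show ?case unfolding F1 by (intro exI[of _ 0]) simp
next
  case (step n)
  let ?f = "ivl_prob c F" and ?g = "ivl_prob c G" and ?h = "ivl_prob c (conv_power F n)"
  have H: "nonneg_dist (conv_power F n)" by (rule nonneg_dist_conv_power[OF F(1)])
  have hg: "\<forall>\<^sub>F x in at_top. ?h x \<le> (4 * n + 5) * ?g x"
  proof -
    obtain T where T: "T \<ge> 0" "\<forall>\<^sub>F x in at_top. ?h x \<le> (real n + 1) * ?f (x - T) + 1 * ?g x"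
      using step.IH[OF zero_less_one] by (elim exE conjE) (rule that)
    have "filterlim (\<lambda>x::real. x - T) at_top at_top" by real_asymp
    from eventually_compose_filterlim[OF dom this]
    show ?thesis
      using T(2) class_L_shift_back(1)[OF G(2) zero_less_one T(1)]
    proof eventually_elim
      case (elim x)
      then have "?f (x - T) \<le> 4 * ?g x" by simp
      then have "(n + 1) * ?f (x - T) \<le> (n + 1) * (4 * ?g x)" by (intro mult_left_mono) auto
      then show ?case using elim(2) by (simp add: algebra_simps)
    qed
  qed
  have fg: "\<forall>\<^sub>F x in at_top. ?f x \<le> (4 * n + 5) * ?g x"
    using dom
  proof eventually_elim
    case (elim x)
    have "2 * ?g x \<le> (4 * n + 5) * ?g x" by (intro mult_right_mono ivl_prob_nonneg) simp
    then show ?case using elim by linarith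
  qed
  \<comment> \<open>The bounds on \<open>\<delta>\<close> give \<open>(n + 1 + \<delta>) * (1 + \<delta>) \<le> n + 1 + \<epsilon>\<close> and \<open>(2 * C + 1) * \<delta> \<le> \<epsilon>\<close>.\<close>
  define \<delta> where "\<delta> = min 1 (min (\<epsilon> / (n + 3)) (\<epsilon> / (2 * C + 1)))"
  have \<delta>: "0 < \<delta>" "\<delta> \<le> 1"
    using step.prems G(4) by (auto simp: \<delta>_def)
  have "\<delta> \<le> \<epsilon> / (n + 3)" "\<delta> \<le> \<epsilon> / (2 * C + 1)" by (simp_all add: \<delta>_def)
  then have \<delta>': "(n + 3) * \<delta> \<le> \<epsilon>" "(2 * C + 1) * \<delta> \<le> \<epsilon>"
    using G(4) by (simp_all add: pos_le_divide_eq mult.commute)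
  obtain x1 where x1: "\<And>s t. x1 \<le> s \<Longrightarrow> s \<le> t \<Longrightarrow> ?f t \<le> (1 + \<delta>) * ?f s"
    using F(3) \<delta>(1) unfolding almost_decreasing_def by metis
  obtain T x2 where T: "T \<ge> 0"
      and x2: "\<And>x. x2 \<le> x \<Longrightarrow> ?h x \<le> (n + \<delta>) * ?f (x - T) + \<delta> * ?g x"
    using step.IH[OF \<delta>(1)] unfolding eventually_at_top_linorder by auto
  have "\<forall>\<^sub>F A in at_top. \<forall>\<^sub>F x in at_top.
      conv_part c F (conv_power F n) {A<..x - A} x \<le> \<delta> * ?g x"
    by (rule middle_negligible_dominated[OF F(1) H G(1) F(2) _ fg hg middle \<delta>(1)]) auto
  from eventually_happens'[OF _ eventually_conj[OF this eventually_ge_at_top[of 0]]]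
  obtain A where A: "0 \<le> A"
      "\<forall>\<^sub>F x in at_top. conv_part c F (conv_power F n) {A<..x - A} x \<le> \<delta> * ?g x"
    by auto
  \<comment> \<open>Up to \<open>A + c\<close> is taken by the small summand, \<open>T\<close> by the induction hypothesis.\<close>
  define T' where "T' = A + c + T"
  have "\<forall>\<^sub>F x in at_top. ivl_prob c (F \<star> conv_power F n) x
      \<le> (real (Suc n) + \<epsilon>) * ?f (x - T') + \<epsilon> * ?g x"
    using A(2) class_L_locally_bounded_ratio[OF G(2-4), of A]
      eventually_ge_at_top[of "2 * A"] eventually_ge_at_top[of "max (x1 + T') (x2 + A)"]
  proof eventually_elim
    case (elim x)
    have first: "conv_part c F (conv_power F n) {..A} x
        \<le> (n + \<delta>) * ((1 + \<delta>) * ?f (x - T')) + \<delta> * (2 * C * ?g x)"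
    proof (rule conv_part_le_const[OF F(1) H F(2)])
      show "0 \<le> (n + \<delta>) * ((1 + \<delta>) * ?f (x - T')) + \<delta> * (2 * C * ?g x)"
        using \<delta> G(4) by (simp add: ivl_prob_nonneg)
      fix y assume y: "0 \<le> y" "y \<le> A"
      have "?h (x - y) \<le> (n + \<delta>) * ?f (x - y - T) + \<delta> * ?g (x - y)"
        using y elim by (intro x2) auto
      also have "?f (x - y - T) \<le> (1 + \<delta>) * ?f (x - T')"
        using y elim F(2) by (intro x1) (auto simp: T'_def)
      also have "?g (x - y) \<le> 2 * C * ?g x" using y elim by blast
      finally show "?h (x - y) \<le> (n + \<delta>) * ((1 + \<delta>) * ?f (x - T')) + \<delta> * (2 * C * ?g x)"
        using \<delta> by simp
    qed
    have third: "conv_part c (conv_power F n) F {..A + c} x \<le> (1 + \<delta>) * ?f (x - T')"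
      using \<delta> T elim by (intro conv_part_le_const[OF H F(1,2)] x1) (auto simp: T'_def ivl_prob_nonneg)
    have "\<delta> * \<delta> \<le> \<delta>" using \<delta> by (simp add: mult_le_cancel_left1)
    then have "(n + \<delta>) * (1 + \<delta>) + (1 + \<delta>) \<le> real (Suc n) + \<epsilon>"
      using \<delta>'(1) by (simp add: algebra_simps)
    then have coeff: "((n + \<delta>) * (1 + \<delta>) + (1 + \<delta>)) * ?f (x - T') \<le> (real (Suc n) + \<epsilon>) * ?f (x - T')"
      by (intro mult_right_mono ivl_prob_nonneg)
    have "(2 * C + 1) * \<delta> * ?g x \<le> \<epsilon> * ?g x"
      using \<delta>'(2) by (intro mult_right_mono ivl_prob_nonneg)
    then show ?case
      using coeff first third elim(1) ivl_prob_convolution_le[OF F(1) H F(2) elim(3)]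
      by (simp add: algebra_simps)
  qed
  moreover have "T' \<ge> 0" using A T F(2) by (simp add: T'_def)
  ultimately show ?case by auto
qed

section \<open>Convolution roots\<close>

lemma root_in_S_Delta:
  assumes F: "nonneg_dist F" "c > 0" "F \<in> A_Delta c"
    and N: "1 \<le> N" "conv_power F N \<in> S_Delta c"
  shows "F \<in> S_Delta c"
proof -
  define G where "G = conv_power F N"
  let ?f = "ivl_prob c F" and ?g = "ivl_prob c G"
  have G: "nonneg_dist G" "G \<in> S_Delta c" "?g \<in> class_L"
    using N nonneg_dist_conv_power[OF F(1)] by (auto simp: G_def S_Delta_def L_Delta_def)
  have dec: "almost_decreasing ?f" and pos: "\<forall>\<^sub>F x in at_top. 0 < ?f x"
    using F(3) asymp_nonincreasing_almost_decreasing asymp_nonincreasing_eventually_pos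
    by (auto simp: A_Delta_def)
  have sd: "shift_dominated (2 * real N) ?g"
    unfolding G_def
    by (intro shift_dominated_conv_power F N almost_decreasing_shift_dominated dec)
  have lower: "\<forall>\<^sub>F x in at_top. (n - \<epsilon>) * ?f x \<le> ivl_prob c (conv_power F n) x"
    if "1 \<le> n" "0 < \<epsilon>" for n and \<epsilon> :: real
    by (rule conv_power_ge[OF F(1,2) dec that])
  have NR: "1 \<le> real N" using N by simp
  have "\<forall>\<^sub>F x in at_top. (N - 1 / 2) * ?f x \<le> ?g x"
    unfolding G_def by (rule lower) (use N in auto)
  then have fg: "\<forall>\<^sub>F x in at_top. ?f x \<le> 2 * ?g x"
  proof eventually_elim
    case (elim x)
    have "1 / 2 * ?f x \<le> (N - 1 / 2) * ?f x"
      using NR by (intro mult_right_mono ivl_prob_nonneg) simp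
    then show ?case using elim by simp
  qed
  have upper: "\<exists>T\<ge>0. \<forall>\<^sub>F x in at_top.
      ivl_prob c (conv_power F n) x \<le> (n + \<epsilon>) * ?f (x - T) + \<epsilon> * ?g x"
    if "1 \<le> n" "0 < \<epsilon>" for n and \<epsilon> :: real
    by (rule conv_power_le[OF F(1,2) dec G(1,3) sd _ fg _ that])
       (auto intro: S_Delta_middle_negligible[OF G(1) F(2) G(2) sd])
  have gNf: "?g \<sim>[at_top] (\<lambda>x. N * ?f x)"
  proof (rule asymp_equivI_eventually_bounds)
    show "\<forall>\<^sub>F x in at_top. 0 < N * ?f x"
      using pos by eventually_elim (use NR in simp)
  next
    fix \<epsilon> :: real assume "\<epsilon> > 0"
    then have "\<forall>\<^sub>F x in at_top. (N - \<epsilon> * N) * ?f x \<le> ?g x"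
      unfolding G_def using N by (intro lower) auto
    then show "\<forall>\<^sub>F x in at_top. (1 - \<epsilon>) * (N * ?f x) \<le> ?g x"
      by eventually_elim (simp add: algebra_simps)
  next
    fix \<epsilon> :: real assume "\<epsilon> > 0"
    \<comment> \<open>This is the solution of \<open>1 + 3 * \<delta> = (1 + \<epsilon>) * (1 - \<delta>)\<close>, and \<open>(1 + \<delta>)\<^sup>2 \<le> 1 + 3 * \<delta>\<close>.\<close>
    define \<delta> where "\<delta> = \<epsilon> / (4 + \<epsilon>)"
    have \<delta>: "0 < \<delta>" "\<delta> < 1" "(4 + \<epsilon>) * \<delta> = \<epsilon>"
      using \<open>\<epsilon> > 0\<close> by (auto simp: \<delta>_def)
    obtain T where T: "T \<ge> 0" "\<forall>\<^sub>F x in at_top. ?g x \<le> (N + \<delta>) * ?f (x - T) + \<delta> * ?g x"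
      using upper[OF N(1) \<delta>(1)] unfolding G_def by auto
    \<comment> \<open>Evaluate the bound at \<open>x + T\<close> and use that \<open>G\<close> is long-tailed to return to \<open>x\<close>.\<close>
    have lim: "filterlim (\<lambda>x::real. x + T) at_top at_top" by real_asymp
    show "\<forall>\<^sub>F x in at_top. ?g x \<le> (1 + \<epsilon>) * (N * ?f x)"
      using eventually_compose_filterlim[OF T(2) lim]
        eventually_compose_filterlim[OF class_L_shift_back(1)[OF G(3) \<delta>(1) T(1)] lim]
    proof eventually_elim
      case (elim x)
      have "\<delta> * \<delta> \<le> \<delta>" using \<delta> by (simp add: mult_le_cancel_left1)
      then have c1: "(1 + \<delta>) * (1 + \<delta>) \<le> (1 + \<epsilon>) * (1 - \<delta>)"
        using \<delta>(3) by (simp add: algebra_simps)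
      have "(1 - \<delta>) * ?g x \<le> (1 - \<delta>) * ((1 + \<delta>) * ?g (x + T))"
        using elim \<delta> by (intro mult_left_mono) auto
      also have "\<dots> = (1 + \<delta>) * ((1 - \<delta>) * ?g (x + T))" by simp
      also have "\<dots> \<le> (1 + \<delta>) * ((N + \<delta>) * ?f x)"
        using elim \<delta> by (intro mult_left_mono) (auto simp: algebra_simps)
      also have "\<dots> \<le> (1 + \<delta>) * ((N * (1 + \<delta>)) * ?f x)"
        using \<delta> NR by (intro mult_left_mono mult_right_mono ivl_prob_nonneg)
          (auto simp: algebra_simps)
      also have "\<dots> = ((1 + \<delta>) * (1 + \<delta>)) * (N * ?f x)" by simp
      also have "\<dots> \<le> ((1 + \<epsilon>) * (1 - \<delta>)) * (N * ?f x)"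
        using c1 by (intro mult_right_mono) (auto simp: ivl_prob_nonneg)
      finally have "(1 - \<delta>) * ?g x \<le> (1 - \<delta>) * ((1 + \<epsilon>) * (N * ?f x))" by (simp add: mult_ac)
      then show ?case using \<delta>(2) by simp
    qed
  qed
  have Nf: "(\<lambda>x. N * ?f x) \<sim>[at_top] ?g" using gNf by (rule asymp_equiv_symI)
  have fL: "?f \<in> class_L"
    unfolding class_L_def
  proof (intro CollectI conjI allI impI)
    show "?f \<in> borel_measurable borel" by (rule ivl_prob_measurable[OF F(1,2)])
    show "0 \<le> ?f x" for x by (rule ivl_prob_nonneg)
    obtain x0 where "\<And>x. x0 \<le> x \<Longrightarrow> 0 < ?f x"
      using pos unfolding eventually_at_top_linorder by auto
    then show "\<exists>x0>0. \<forall>x\<ge>x0. 0 < ?f x" by (intro exI[of _ "max x0 1"]) auto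
    fix y :: real assume "y > 0"
    have "filterlim (\<lambda>x::real. x + y) at_top at_top" by real_asymp
    from asymp_equiv_compose'[OF Nf this]
    have "(\<lambda>x. N * ?f (x + y)) \<sim>[at_top] (\<lambda>x. ?g (x + y))" .
    also have "(\<lambda>x. ?g (x + y)) \<sim>[at_top] ?g"
      using G(3) \<open>y > 0\<close> unfolding class_L_def by simp
    also note gNf
    finally have "(\<lambda>x. N * ?f (x + y)) \<sim>[at_top] (\<lambda>x. N * ?f x)" .
    from asymp_equiv_mult[OF asymp_equiv_refl this]
    have "(\<lambda>x. (1 / N) * (N * ?f (x + y))) \<sim>[at_top] (\<lambda>x. (1 / N) * (N * ?f x))" .
    then show "(\<lambda>x. ?f (x + y)) \<sim>[at_top] ?f" using NR by simp
  qed
  have "ivl_prob c (conv_power F 2) \<sim>[at_top] (\<lambda>x. 2 * ?f x)"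
  proof (rule asymp_equivI_eventually_bounds)
    show "\<forall>\<^sub>F x in at_top. 0 < 2 * ?f x"
      using pos by eventually_elim simp
  next
    fix \<epsilon> :: real assume "\<epsilon> > 0"
    then have "\<forall>\<^sub>F x in at_top. (real 2 - 2 * \<epsilon>) * ?f x \<le> ivl_prob c (conv_power F 2) x"
      by (intro lower) auto
    then show "\<forall>\<^sub>F x in at_top. (1 - \<epsilon>) * (2 * ?f x) \<le> ivl_prob c (conv_power F 2) x"
      by eventually_elim (simp add: algebra_simps)
  next
    fix \<epsilon> :: real assume "\<epsilon> > 0"
    define \<delta> where "\<delta> = min 1 (\<epsilon> / (2 + N))"
    have "0 < \<delta>" "\<delta> \<le> 1" "\<delta> \<le> \<epsilon> / (2 + N)"
      using \<open>\<epsilon> > 0\<close> by (simp_all add: \<delta>_def)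
    then have \<delta>: "0 < \<delta>" "\<delta> \<le> 1" "(2 + N) * \<delta> \<le> \<epsilon>"
      by (simp_all add: pos_le_divide_eq mult.commute)
    obtain T where T: "T \<ge> 0" "\<forall>\<^sub>F x in at_top.
        ivl_prob c (conv_power F 2) x \<le> (real 2 + \<delta>) * ?f (x - T) + \<delta> * ?g x"
      using upper[OF one_le_numeral \<delta>(1)] by blast
    have "\<forall>\<^sub>F x in at_top. 0 < N * ?f x"
      using pos by eventually_elim (use NR in simp)
    from T(2) class_L_shift_back(1)[OF fL \<delta>(1) T(1)]
      asymp_equiv_eventually_bounds[OF gNf this zero_less_one]
    show "\<forall>\<^sub>F x in at_top. ivl_prob c (conv_power F 2) x \<le> (1 + \<epsilon>) * (2 * ?f x)"
    proof eventually_elim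
      case (elim x)
      have "\<delta> * \<delta> \<le> \<delta>" using \<delta> by (simp add: mult_le_cancel_left1)
      then have coeff: "(2 + \<delta>) * (1 + \<delta>) + \<delta> * (2 * N) \<le> 2 + 2 * \<epsilon>"
        using \<delta>(3) by (simp add: algebra_simps)
      have "ivl_prob c (conv_power F 2) x \<le> (2 + \<delta>) * ((1 + \<delta>) * ?f x) + \<delta> * (2 * (N * ?f x))"
        using elim \<delta> by (intro order_trans[OF elim(1)] add_mono mult_mono) (auto simp: ivl_prob_nonneg)
      also have "\<dots> = ((2 + \<delta>) * (1 + \<delta>) + \<delta> * (2 * N)) * ?f x" by (simp add: algebra_simps)
      also have "\<dots> \<le> (2 + 2 * \<epsilon>) * ?f x" by (intro mult_right_mono coeff ivl_prob_nonneg)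
      finally show ?case by (simp add: algebra_simps)
    qed
  qed
  with fL show ?thesis by (simp add: S_Delta_def L_Delta_def)
qed

theorem proposition3p3:
  fixes F :: "real measure" and N :: nat
  assumes "real_distribution F"
    and "measure F {0..} = 1"
    and "N \<ge> 1"
  shows "(\<forall>c>0. F \<in> A_Delta c \<and> conv_power F N \<in> S_Delta c \<longrightarrow> F \<in> S_Delta c) \<and>
         (F \<in> A_loc \<and> conv_power F N \<in> S_loc \<longrightarrow> F \<in> S_loc)"
proof -
  have "F \<in> S_Delta c" if "c > 0" "F \<in> A_Delta c" "conv_power F N \<in> S_Delta c" for c
    using that assms by (intro root_in_S_Delta[of F c N]) (auto simp: nonneg_dist_def)
  then show ?thesis by (auto simp: A_loc_def S_loc_def)
qed

end
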